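(* Let $u$ be a harmonic function in the open upper half-plane $\mathbb{H}$ which is of temperate growth at infinity. Assume that (1) $u(z)\to 0$ as $\mathbb{H}\ni z\to x$ for every $x\in\mathbb{R}$; and (2) there are $x_1,x_2\in\mathbb{R}$ with $x_1\neq x_2$ such that $\displaystyle\lim_{y\to+\infty}u(x+iy)/y=0$ for $x=x_1$ and for $x=x_2$. Then $u(z)=0$ for all $z\in\mathbb{H}$.
   Context: $\mathbb{H}=\{z\in\mathbb{C}:\operatorname{Im} z>0\}$ is the open upper half-plane. Harmonic functions are complex-valued $C^2$ functions annihilated by the usual Laplacian. A function $u$ in $\mathbb{H}$ is of temperate growth at infinity if there are positive constants $C,R,N$ such that $|u(z)|\leq C\,(|z|^2/\operatorname{Im} z)^N$ for all $z\in\mathbb{H}$ with $|z|>R$. *)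

theory Defs
  imports "HOL-Analysis.Analysis"
begin

definition upper_half_plane :: "complex set"
  where "upper_half_plane = {z. Im z > 0}"

text \<open>
  \<open>Ck_on k S f\<close>: \<open>f\<close> is of class \<open>C\<^sup>k\<close> on \<open>S\<close>, which is meant to be open. Continuity of the derivative
  is stated for each direction \<open>v\<close>; as the domain is finite-dimensional, this is the same as
  continuity in operator norm.
\<close>

primrec Ck_on ::
    "nat \<Rightarrow> 'a::euclidean_space set \<Rightarrow> ('a \<Rightarrow> 'b::real_normed_vector) \<Rightarrow> bool" where
  "Ck_on 0 S f \<longleftrightarrow> continuous_on S f"
| "Ck_on (Suc k) S f \<longleftrightarrow>
     (\<forall>z\<in>S. f differentiable (at z)) \<and> (\<forall>v. Ck_on k S (\<lambda>z. frechet_derivative f (at z) v))"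

text \<open>On \<open>\<complex>\<close> the basis is \<open>{1, \<i>}\<close>, so this is \<open>\<partial>\<^sup>2f/\<partial>x\<^sup>2 + \<partial>\<^sup>2f/\<partial>y\<^sup>2\<close>.\<close>

definition laplacian ::
    "('a::euclidean_space \<Rightarrow> 'b::real_normed_vector) \<Rightarrow> 'a \<Rightarrow> 'b" where
  "laplacian f z =
     (\<Sum>b\<in>Basis. frechet_derivative (\<lambda>w. frechet_derivative f (at w) b) (at z) b)"

definition harmonic_on ::
    "'a::euclidean_space set \<Rightarrow> ('a \<Rightarrow> 'b::real_normed_vector) \<Rightarrow> bool" where
  "harmonic_on S f \<longleftrightarrow> open S \<and> Ck_on 2 S f \<and> (\<forall>z\<in>S. laplacian f z = 0)"

definition temperate_growth_at_infinity :: "(complex \<Rightarrow> complex) \<Rightarrow> bool" where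
  "temperate_growth_at_infinity u \<longleftrightarrow>
     (\<exists>C R N :: real. C > 0 \<and> R > 0 \<and> N > 0 \<and>
        (\<forall>z\<in>upper_half_plane. norm z > R \<longrightarrow>
           norm (u z) \<le> C * ((norm z)\<^sup>2 / Im z) powr N))"

end

theory Submission
  imports Defs "HOL-Complex_Analysis.Complex_Analysis"
    "HOL-Computational_Algebra.Fundamental_Theorem_Algebra"
begin

text \<open>
  The real and imaginary parts of \<open>u\<close> are imaginary parts of holomorphic functions \<open>F\<close>. Comparison
  with a quadratic barrier on half-discs shows that \<open>Im F\<close> is \<open>O(Im z)\<close> near the real axis, so \<open>F'\<close>
  is bounded there and \<open>F\<close> extends continuously to the axis, where it is real. By Schwarz reflection
  \<open>F\<close> is the restriction of an entire function \<open>G\<close>. Temperate growth bounds \<open>G'\<close> by a multiple of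
  \<open>(|z|\<^sup>2 / |Im z|)\<^sup>n\<close>; multiplying by \<open>(z\<^sup>2 - \<rho>\<^sup>2)\<^sup>n\<close>, which on \<open>|z| = \<rho>\<close> compensates the
  singularity on the axis, shows that \<open>G\<close> is a polynomial. Finally
  \<open>G (x\<^sub>j + i y) - G (x\<^sub>j - i y) = 2 i Im G (x\<^sub>j + i y) = o(y)\<close> forces \<open>G\<close> to be symmetric
  about both \<open>x\<^sub>1\<close> and \<open>x\<^sub>2\<close>, hence periodic, hence a real constant.
\<close>

section \<open>Harmonic functions and holomorphic functions\<close>

text \<open>The mean value theorem is used twice: along \<open>v\<close> for the increment
  \<open>g\<close> in direction \<open>w\<close>, then along \<open>w\<close> for the directional
  derivative \<open>D _ v\<close>. The second difference on the left is symmetric in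
  \<open>v\<close> and \<open>w\<close>, which lets it link the two mixed derivatives.\<close>

lemma second_difference_MVT:
  fixes f :: "'a::real_normed_vector \<Rightarrow> real"
  assumes f: "\<And>z. z \<in> S \<Longrightarrow> (f has_derivative D z) (at z)"
    and D: "\<And>z. z \<in> S \<Longrightarrow> ((\<lambda>z. D z v) has_derivative E z) (at z)"
    and "0 < h"
    and S: "\<And>s t. 0 \<le> s \<Longrightarrow> s \<le> h \<Longrightarrow> 0 \<le> t \<Longrightarrow> t \<le> h \<Longrightarrow> z + s *\<^sub>R v + t *\<^sub>R w \<in> S"
  obtains s t where "0 < s" "s < h" "0 < t" "t < h"
    "f (z + h *\<^sub>R v + h *\<^sub>R w) - f (z + h *\<^sub>R v) - f (z + h *\<^sub>R w) + f z
      = h\<^sup>2 * E (z + s *\<^sub>R v + t *\<^sub>R w) w"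
proof -
  define g where "g s = f (z + s *\<^sub>R v + h *\<^sub>R w) - f (z + s *\<^sub>R v)" for s
  have f': "((\<lambda>s. f (z + s *\<^sub>R v + t *\<^sub>R w)) has_real_derivative D (z + s *\<^sub>R v + t *\<^sub>R w) v) (at s)"
    if "0 \<le> s" "s \<le> h" "0 \<le> t" "t \<le> h" for s t
  proof -
    have "((\<lambda>s. z + s *\<^sub>R v + t *\<^sub>R w) has_derivative (\<lambda>x. x *\<^sub>R v)) (at s)"
      by (auto intro!: derivative_eq_intros)
    from has_derivative_compose[OF this f[OF S[OF that]]]
    have "((\<lambda>s. f (z + s *\<^sub>R v + t *\<^sub>R w)) has_derivative (\<lambda>x. D (z + s *\<^sub>R v + t *\<^sub>R w) (x *\<^sub>R v))) (at s)" .
    moreover have "(\<lambda>x. D (z + s *\<^sub>R v + t *\<^sub>R w) (x *\<^sub>R v)) = (*) (D (z + s *\<^sub>R v + t *\<^sub>R w) v)"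
      using linear_scale[OF has_derivative_linear[OF f[OF S[OF that]]]] by (auto simp: mult.commute)
    ultimately show ?thesis
      by (simp add: has_field_derivative_def)
  qed
  have "(g has_real_derivative (D (z + s *\<^sub>R v + h *\<^sub>R w) v - D (z + s *\<^sub>R v) v)) (at s)"
    if "0 \<le> s" "s \<le> h" for s
    unfolding g_def using f'[OF that, of h] f'[OF that, of 0] \<open>0 < h\<close>
    by (auto intro!: derivative_intros)
  from MVT2[OF \<open>0 < h\<close> this] obtain s where s: "0 < s" "s < h"
    and gs: "g h - g 0 = h * (D (z + s *\<^sub>R v + h *\<^sub>R w) v - D (z + s *\<^sub>R v) v)" by auto
  have "((\<lambda>t. D (z + s *\<^sub>R v + t *\<^sub>R w) v) has_real_derivative E (z + s *\<^sub>R v + t *\<^sub>R w) w) (at t)"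
    if "0 \<le> t" "t \<le> h" for t
  proof -
    have zS: "z + s *\<^sub>R v + t *\<^sub>R w \<in> S" using S s that by auto
    have "((\<lambda>t. z + s *\<^sub>R v + t *\<^sub>R w) has_derivative (\<lambda>x. x *\<^sub>R w)) (at t)"
      by (auto intro!: derivative_eq_intros)
    from has_derivative_compose[OF this D[OF zS]]
    have "((\<lambda>t. D (z + s *\<^sub>R v + t *\<^sub>R w) v) has_derivative (\<lambda>x. E (z + s *\<^sub>R v + t *\<^sub>R w) (x *\<^sub>R w))) (at t)" .
    moreover have "(\<lambda>x. E (z + s *\<^sub>R v + t *\<^sub>R w) (x *\<^sub>R w)) = (*) (E (z + s *\<^sub>R v + t *\<^sub>R w) w)"
      using linear_scale[OF has_derivative_linear[OF D[OF zS]]] by (auto simp: mult.commute)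
    ultimately show ?thesis
      by (simp add: has_field_derivative_def)
  qed
  from MVT2[OF \<open>0 < h\<close> this] obtain t where t: "0 < t" "t < h"
    and "D (z + s *\<^sub>R v + h *\<^sub>R w) v - D (z + s *\<^sub>R v) v = h * E (z + s *\<^sub>R v + t *\<^sub>R w) w" by auto
  with gs have "f (z + h *\<^sub>R v + h *\<^sub>R w) - f (z + h *\<^sub>R v) - f (z + h *\<^sub>R w) + f z
      = h\<^sup>2 * E (z + s *\<^sub>R v + t *\<^sub>R w) w"
    by (simp add: g_def power2_eq_square algebra_simps)
  with s t show ?thesis using that by blast
qed

text \<open>This is the Clairaut-Schwarz theorem. Evaluating one second difference in both orders
  makes the two mixed derivatives agree at two points of a small parallelogram at \<open>z\<close>.
  By continuity each value is within half the supposed gap of its value at \<open>z\<close>, a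
  contradiction.\<close>

lemma mixed_second_derivatives_eq:
  fixes f :: "'a::real_normed_vector \<Rightarrow> real"
  assumes "open S" "z \<in> S"
    and f: "\<And>z. z \<in> S \<Longrightarrow> (f has_derivative D z) (at z)"
    and Dv: "\<And>z. z \<in> S \<Longrightarrow> ((\<lambda>z. D z v) has_derivative E z) (at z)"
    and Dw: "\<And>z. z \<in> S \<Longrightarrow> ((\<lambda>z. D z w) has_derivative F z) (at z)"
    and contE: "continuous_on S (\<lambda>z. E z w)"
    and contF: "continuous_on S (\<lambda>z. F z v)"
  shows "E z w = F z v"
proof (rule ccontr)
  assume ne: "E z w \<noteq> F z v"
  define e where "e = \<bar>E z w - F z v\<bar> / 2"
  have "e > 0" using ne by (simp add: e_def)
  have "isCont (\<lambda>z. E z w) z" "isCont (\<lambda>z. F z v) z"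
    using contE contF \<open>open S\<close> \<open>z \<in> S\<close> continuous_on_eq_continuous_at by blast+
  then obtain d1 d2 where d1: "d1 > 0" "\<And>x. dist x z < d1 \<Longrightarrow> dist (E x w) (E z w) < e"
    and d2: "d2 > 0" "\<And>x. dist x z < d2 \<Longrightarrow> dist (F x v) (F z v) < e"
    unfolding continuous_at_eps_delta using \<open>e > 0\<close> by metis
  obtain d3 where d3: "d3 > 0" "ball z d3 \<subseteq> S" using \<open>open S\<close> \<open>z \<in> S\<close> openE by blast
  define d where "d = min d1 (min d2 d3)"
  \<comment> \<open>With this \<open>h\<close> the parallelogram spanned by \<open>h v\<close> and
    \<open>h w\<close> stays within \<open>d\<close> of \<open>z\<close>, hence inside
    \<open>S\<close> and both continuity neighbourhoods. The summand 1 keeps the denominator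
    positive when \<open>v\<close> and \<open>w\<close> vanish.\<close>
  define h where "h = d / (2 * (norm v + norm w + 1))"
  have nz: "norm v + norm w + 1 > 0" by (smt (verit) norm_ge_zero)
  have "d > 0" using d1 d2 d3 by (simp add: d_def)
  then have "h > 0" using nz by (simp add: h_def)
  have near: "dist (z + s *\<^sub>R v + t *\<^sub>R w) z < d" if "0 \<le> s" "s \<le> h" "0 \<le> t" "t \<le> h" for s t
  proof -
    have "dist (z + s *\<^sub>R v + t *\<^sub>R w) z = norm (s *\<^sub>R v + t *\<^sub>R w)" by (simp add: dist_norm algebra_simps)
    also have "\<dots> \<le> s * norm v + t * norm w"
      using norm_triangle_ineq[of "s *\<^sub>R v" "t *\<^sub>R w"] that by simp
    also have "\<dots> \<le> h * norm v + h * norm w"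
      using that by (intro add_mono mult_right_mono) auto
    also have "\<dots> < 2 * h * (norm v + norm w + 1)"
    proof -
      have "h * norm v \<ge> 0" "h * norm w \<ge> 0" using \<open>h > 0\<close> by simp_all
      then show ?thesis using \<open>h > 0\<close> unfolding ring_distribs by linarith
    qed
    also have "\<dots> = d" using nz by (simp add: h_def field_simps)
    finally show ?thesis .
  qed
  have S1: "z + s *\<^sub>R v + t *\<^sub>R w \<in> S" if "0 \<le> s" "s \<le> h" "0 \<le> t" "t \<le> h" for s t
    using near[OF that] d3 by (force simp: d_def dist_commute)
  have S2: "z + s *\<^sub>R w + t *\<^sub>R v \<in> S" if "0 \<le> s" "s \<le> h" "0 \<le> t" "t \<le> h" for s t
    using S1[of t s] that by (simp add: ac_simps)
  obtain s t where st: "0 < s" "s < h" "0 < t" "t < h"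
    "f (z + h *\<^sub>R v + h *\<^sub>R w) - f (z + h *\<^sub>R v) - f (z + h *\<^sub>R w) + f z
      = h\<^sup>2 * E (z + s *\<^sub>R v + t *\<^sub>R w) w"
    using second_difference_MVT[OF f Dv \<open>h > 0\<close> S1] by blast
  obtain s' t' where st': "0 < s'" "s' < h" "0 < t'" "t' < h"
    "f (z + h *\<^sub>R w + h *\<^sub>R v) - f (z + h *\<^sub>R w) - f (z + h *\<^sub>R v) + f z
      = h\<^sup>2 * F (z + s' *\<^sub>R w + t' *\<^sub>R v) v"
    using second_difference_MVT[OF f Dw \<open>h > 0\<close> S2] by blast
  have "h\<^sup>2 * E (z + s *\<^sub>R v + t *\<^sub>R w) w = h\<^sup>2 * F (z + s' *\<^sub>R w + t' *\<^sub>R v) v"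
    using st(5) st'(5)[unfolded add.assoc add.commute[of "h *\<^sub>R w" "h *\<^sub>R v"]]
    unfolding add.assoc by linarith
  then have eq: "E (z + s *\<^sub>R v + t *\<^sub>R w) w = F (z + t' *\<^sub>R v + s' *\<^sub>R w) v"
    using \<open>h > 0\<close> by (simp add: ac_simps)
  have "dist (E (z + s *\<^sub>R v + t *\<^sub>R w) w) (E z w) < e"
    using d1(2) near[of s t] st by (simp add: d_def)
  moreover have "dist (F (z + t' *\<^sub>R v + s' *\<^sub>R w) v) (F z v) < e"
    using d2(2) near[of t' s'] st' by (simp add: d_def)
  ultimately show False
    using eq unfolding e_def dist_real_def by (smt (verit) field_sum_of_halves)
qed

text \<open>\<open>L\<close> stands for \<open>Re\<close> or \<open>Im\<close>, so that a complex
  harmonic function is treated through two real ones. The candidate for the derivative of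
  \<open>F\<close> is holomorphic by the Cauchy-Riemann equations, and convexity of \<open>S\<close>
  gives it a primitive. The imaginary part of this primitive differs from \<open>L (u z)\<close> by
  a real constant, which is then subtracted.\<close>

lemma harmonic_on_imp_Im_holomorphic:
  fixes u :: "complex \<Rightarrow> 'b::real_normed_vector"
  assumes harm: "harmonic_on S u" and "convex S" and L: "bounded_linear L"
  obtains F where "F holomorphic_on S" "\<And>z. z \<in> S \<Longrightarrow> Im (F z) = L (u z)"
proof -
  define D where "D z h = L (frechet_derivative u (at z) h)" for z h
  define E where "E v z h = L (frechet_derivative (\<lambda>w. frechet_derivative u (at w) v) (at z) h)" for v z h
  have "open S" using harm by (simp add: harmonic_on_def)
  have dL: "(L has_derivative L) F" for F
    by (rule bounded_linear_imp_has_derivative[OF L])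
  have D: "((\<lambda>z. L (u z)) has_derivative D z) (at z)" if "z \<in> S" for z
    using harm that has_derivative_compose[OF _ dL] frechet_derivative_works
    unfolding D_def harmonic_on_def numeral_2_eq_2 Ck_on.simps by blast
  have E: "((\<lambda>z. D z v) has_derivative E v z) (at z)" if "z \<in> S" for z v
    using harm that has_derivative_compose[OF _ dL] frechet_derivative_works
    unfolding D_def E_def harmonic_on_def numeral_2_eq_2 Ck_on.simps by blast
  have cont: "continuous_on S (\<lambda>z. E v z w)" for v w
    using harm bounded_linear.continuous_on[OF L]
    unfolding E_def harmonic_on_def numeral_2_eq_2 Ck_on.simps by blast
  have sym: "E 1 z \<i> = E \<i> z 1" if "z \<in> S" for z
    using mixed_second_derivatives_eq[OF \<open>open S\<close> that D E E cont cont] .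
  have lap: "E \<i> z \<i> = - E 1 z 1" if "z \<in> S" for z
  proof -
    have "L (laplacian u z) = 0"
      using harm that linear_0[OF bounded_linear.linear[OF L]] by (simp add: harmonic_on_def)
    then show ?thesis
      by (simp add: laplacian_def Basis_complex_def E_def linear_add[OF bounded_linear.linear[OF L]])
  qed
  have split: "A h = Re h * A 1 + Im h * A \<i>" if "linear A" for A :: "complex \<Rightarrow> real" and h
  proof -
    have "A h = A (Re h *\<^sub>R 1 + Im h *\<^sub>R \<i>)" by (rule arg_cong[of _ _ A]) (simp add: complex_eq_iff)
    then show ?thesis by (simp only: linear_add[OF that] linear_scale[OF that] real_scaleR_def)
  qed
  \<comment> \<open>If \<open>v = Im F\<close> then \<open>F' = v\<^sub>y + i v\<^sub>x\<close>.\<close>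
  define g where "g z = Complex (D z \<i>) (D z 1)" for z
  have "(g has_field_derivative Complex (E \<i> z 1) (E 1 z 1)) (at z)" if z: "z \<in> S" for z
  proof -
    have "((\<lambda>z. complex_of_real (D z \<i>) + \<i> * complex_of_real (D z 1)) has_derivative
       (\<lambda>h. complex_of_real (E \<i> z h) + \<i> * complex_of_real (E 1 z h))) (at z)"
      using E[OF z] by (intro derivative_intros)
    \<comment> \<open>These are the Cauchy-Riemann equations for \<open>g\<close>: symmetry of the
      mixed derivatives gives one of them, the Laplace equation the other. Hence the real derivative
      of \<open>g\<close> is multiplication by a complex number.\<close>
    moreover have "(\<lambda>h. complex_of_real (E \<i> z h) + \<i> * complex_of_real (E 1 z h)) = (*) (Complex (E \<i> z 1) (E 1 z 1))"
    proof
      fix h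
      show "complex_of_real (E \<i> z h) + \<i> * complex_of_real (E 1 z h) = Complex (E \<i> z 1) (E 1 z 1) * h"
        using sym[OF z] lap[OF z] 
        by (subst (1 2) split) (use has_derivative_linear[OF E[OF z]] in \<open>auto simp: complex_eq_iff algebra_simps\<close>)
    qed
    ultimately show ?thesis
      by (simp add: has_field_derivative_def g_def [abs_def] Complex_eq)
  qed
  then have "g holomorphic_on S"
    using \<open>open S\<close> by (auto simp: holomorphic_on_open)
  then obtain f where f: "\<And>z. z \<in> S \<Longrightarrow> (f has_field_derivative g z) (at z)"
    using holomorphic_convex_primitive'[OF \<open>convex S\<close> \<open>open S\<close>] at_within_open[OF _ \<open>open S\<close>] by metis
  have "((\<lambda>z. Im (f z) - L (u z)) has_derivative (\<lambda>h. 0)) (at z within S)" if z: "z \<in> S" for z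
  proof -
    have "((\<lambda>z. Im (f z) - L (u z)) has_derivative (\<lambda>h. Im (g z * h) - D z h)) (at z)"
      using f[OF z] D[OF z] unfolding has_field_derivative_def by (intro derivative_intros)
    moreover have "Im (g z * h) - D z h = 0" for h
      using split[OF has_derivative_linear[OF D[OF z]], of h] by (simp add: g_def algebra_simps)
    ultimately show ?thesis by (simp add: has_derivative_at_withinI)
  qed
  from has_derivative_zero_constant[OF \<open>convex S\<close> this]
  obtain c where c: "\<And>z. z \<in> S \<Longrightarrow> Im (f z) - L (u z) = c" by blast
  show ?thesis
  proof (rule that[of "\<lambda>z. f z - \<i> * of_real c"])
    show "(\<lambda>z. f z - \<i> * of_real c) holomorphic_on S"
      using f \<open>open S\<close> by (intro holomorphic_intros) (auto simp: holomorphic_on_open)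
  qed (use c in \<open>force simp: algebra_simps\<close>)
qed

section \<open>Boundary behaviour in the upper half-plane\<close>

text \<open>The boundary condition is stated through limits because \<open>F\<close> need not extend
  to the frontier. It keeps the set \<open>K\<close>, where \<open>Im F\<close> is at least
  \<open>e\<close>, away from the frontier of \<open>S\<close>, so \<open>K\<close> is compact
  inside \<open>S\<close>. The maximum modulus principle on \<open>K\<close> for
  \<open>exp (-\<i> * F z)\<close>, whose modulus is \<open>exp (Im (F z))\<close>, then gives the
  bound \<open>e\<close>.\<close>

lemma Im_le_0_maximum_principle:
  assumes F: "F holomorphic_on S" and "open S" "bounded S"
    and bdry: "\<And>\<xi> e. \<xi> \<in> frontier S \<Longrightarrow> 0 < e \<Longrightarrow> \<forall>\<^sub>F z in at \<xi> within S. Im (F z) < e"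
    and "z \<in> S"
  shows "Im (F z) \<le> 0"
proof (rule field_le_epsilon)
  fix e :: real assume "0 < e"
  define K where "K = {z \<in> S. e \<le> Im (F z)}"
  have contF: "continuous_on S F" using F by (rule holomorphic_on_imp_continuous_on)
  have "K \<subseteq> S" by (auto simp: K_def)
  have "closed K"
    unfolding closed_limpt
  proof (intro allI impI)
    fix \<xi> assume lim: "\<xi> islimpt K"
    then have "\<xi> \<in> closure S" using islimpt_subset[OF lim \<open>K \<subseteq> S\<close>] by (simp add: closure_def)
    have nt: "at \<xi> within K \<noteq> bot" using lim by (simp add: trivial_limit_within)
    show "\<xi> \<in> K"
    proof (cases "\<xi> \<in> S")
      case True
      have "(F \<longlongrightarrow> F \<xi>) (at \<xi> within K)"
        using contF True \<open>K \<subseteq> S\<close> by (meson continuous_on_def tendsto_within_subset)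
      then have "((\<lambda>z. Im (F z)) \<longlongrightarrow> Im (F \<xi>)) (at \<xi> within K)" by (rule tendsto_Im)
      moreover have "\<forall>\<^sub>F z in at \<xi> within K. e \<le> Im (F z)"
        by (auto simp: eventually_at_filter K_def)
      ultimately have "e \<le> Im (F \<xi>)" using nt tendsto_lowerbound by blast
      with True show ?thesis by (simp add: K_def)
    next
      case False
      then have "\<xi> \<in> frontier S"
        using \<open>\<xi> \<in> closure S\<close> \<open>open S\<close> by (simp add: frontier_def interior_open)
      from bdry[OF this \<open>0 < e\<close>] have "\<forall>\<^sub>F z in at \<xi> within K. Im (F z) < e"
        using \<open>K \<subseteq> S\<close> by (meson at_le filter_leD)
      moreover have "\<forall>\<^sub>F z in at \<xi> within K. e \<le> Im (F z)"
        by (auto simp: eventually_at_filter K_def)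
      ultimately have "\<forall>\<^sub>F z in at \<xi> within K. False" by eventually_elim auto
      then show ?thesis using nt by (simp add: eventually_False)
    qed
  qed
  have hol: "(\<lambda>z. exp (-\<i> * F z)) holomorphic_on S"
    by (intro holomorphic_intros F)
  show "Im (F z) \<le> 0 + e"
  proof (cases "z \<in> K")
    case True
    have "norm (exp (-\<i> * F z)) \<le> exp e"
    proof (rule maximum_modulus_frontier[where S = K and f = "\<lambda>z. exp (-\<i> * F z)"])
      show "(\<lambda>z. exp (-\<i> * F z)) holomorphic_on interior K"
        using hol \<open>K \<subseteq> S\<close> interior_subset by (meson holomorphic_on_subset subset_trans)
      show "continuous_on (closure K) (\<lambda>z. exp (-\<i> * F z))"
        using hol \<open>K \<subseteq> S\<close> \<open>closed K\<close>
        by (metis closure_closed continuous_on_subset holomorphic_on_imp_continuous_on)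
      show "bounded K" using \<open>bounded S\<close> \<open>K \<subseteq> S\<close> bounded_subset by blast
      fix w assume w: "w \<in> frontier K"
      then have "w \<in> K" using \<open>closed K\<close> frontier_subset_closed by blast
      \<comment> \<open>Points with \<open>Im F\<close> above \<open>e\<close> are interior to
        \<open>K\<close>, so on the frontier of \<open>K\<close> the imaginary part is at most
        \<open>e\<close>.\<close>
      moreover have "\<not> e < Im (F w)"
      proof
        assume "e < Im (F w)"
        have "open {z \<in> S. e < Im (F z)}"
        proof -
          have "continuous_on S (\<lambda>z. Im (F z))" using contF by (intro continuous_intros)
          then have "open (S \<inter> (\<lambda>z. Im (F z)) -` {e<..})"
            using \<open>open S\<close> by (simp add: continuous_on_open_vimage Int_commute continuous_open_preimage)
          moreover have "S \<inter> (\<lambda>z. Im (F z)) -` {e<..} = {z \<in> S. e < Im (F z)}" by auto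
          ultimately show ?thesis by simp
        qed
        moreover have "{z \<in> S. e < Im (F z)} \<subseteq> K" by (auto simp: K_def)
        ultimately have "w \<in> interior K"
          using \<open>e < Im (F w)\<close> \<open>w \<in> K\<close> \<open>K \<subseteq> S\<close> by (intro interiorI) auto
        with w show False by (simp add: frontier_def)
      qed
      ultimately show "norm (exp (-\<i> * F w)) \<le> exp e"
        by simp
    qed (rule True)
    then show ?thesis by simp
  next
    case False
    with \<open>z \<in> S\<close> show ?thesis by (simp add: K_def)
  qed
qed

lemma norm_deriv_le_of_Im_bound:
  assumes F: "F holomorphic_on S" and "open S" "cball z r \<subseteq> S" "0 < r" "0 < m"
    and Im: "\<And>w. w \<in> cball z r \<Longrightarrow> \<bar>Im (F w)\<bar> \<le> m"
  shows "norm (deriv F z) \<le> exp 2 * m / r"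
proof -
  \<comment> \<open>The modulus of \<open>f\<close> lies between \<open>exp (-1)\<close> and \<open>exp 1\<close>, so Cauchy's inequality for \<open>f'\<close>
    bounds \<open>F'\<close>.\<close>
  define f where "f w = exp (-\<i> * F w / of_real m)" for w
  have "z \<in> S" using assms by (simp add: subset_eq)
  have hol: "f holomorphic_on S" unfolding f_def using \<open>0 < m\<close> by (intro holomorphic_intros F) auto
  have nf: "norm (f w) = exp (Im (F w) / m)" for w by (simp add: f_def)
  have "norm ((deriv ^^ 1) f z) \<le> fact 1 * exp 1 / r ^ 1"
  proof (rule Cauchy_inequality)
    show "f holomorphic_on ball z r" "continuous_on (cball z r) f"
      using hol assms(3) ball_subset_cball holomorphic_on_imp_continuous_on
      by (meson holomorphic_on_subset continuous_on_subset order_trans)+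
    show "norm (f w) \<le> exp 1" if "norm (z - w) = r" for w
      using Im[of w] that \<open>0 < m\<close> by (simp add: nf dist_norm field_simps)
  qed (rule \<open>0 < r\<close>)
  moreover have "deriv f z = f z * (-\<i> * deriv F z / of_real m)"
  proof (rule DERIV_imp_deriv)
    have "(F has_field_derivative deriv F z) (at z)"
      using F \<open>open S\<close> \<open>z \<in> S\<close> by (simp add: holomorphic_derivI)
    then show "(f has_field_derivative f z * (-\<i> * deriv F z / of_real m)) (at z)"
      unfolding f_def using \<open>0 < m\<close> by (auto intro!: derivative_eq_intros)
  qed
  ultimately have "exp (Im (F z) / m) * (norm (deriv F z) / m) \<le> exp 1 / r"
    using \<open>0 < m\<close> by (simp add: norm_mult norm_divide nf)
  moreover have "exp (- 1) \<le> exp (Im (F z) / m)"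
    using Im[of z] \<open>0 < r\<close> \<open>0 < m\<close> by (simp add: field_simps abs_le_iff)
  then have "exp (-1) * (norm (deriv F z) / m) \<le> exp (Im (F z) / m) * (norm (deriv F z) / m)"
    using \<open>0 < m\<close> by (intro mult_right_mono) auto
  ultimately have "exp (-1) * (norm (deriv F z) / m) \<le> exp 1 / r" by linarith
  then have "exp 1 * (exp (-1) * (norm (deriv F z) / m)) \<le> exp 1 * (exp 1 / r)"
    by (rule mult_left_mono) simp
  then have "norm (deriv F z) / m \<le> exp 2 / r"
    by (simp add: mult.assoc[symmetric] exp_add[symmetric])
  then show ?thesis using assms by (simp add: field_simps)
qed

section \<open>Linear decay of \<open>Im F\<close> at the real axis and bounds for the
  derivative\<close>

lemma open_upper_half_plane: "open upper_half_plane"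
  unfolding upper_half_plane_def by (rule open_halfspace_Im_gt)

lemma convex_upper_half_plane: "convex upper_half_plane"
  unfolding upper_half_plane_def by (rule convex_halfspace_Im_gt)

text \<open>The bound is one-sided so that it can be applied to both \<open>F\<close> and
  \<open>- F\<close>. Its factor \<open>y\<close> will cancel the radius, proportional to
  \<open>y\<close>, of the discs on which the derivative is estimated.\<close>

lemma Im_le_near_real_axis:
  assumes F: "F holomorphic_on upper_half_plane"
    and lim: "\<And>x::real. ((\<lambda>z. Im (F z)) \<longlongrightarrow> 0) (at (of_real x) within upper_half_plane)"
    and "0 < r"
    and M: "\<And>z. z \<in> upper_half_plane \<Longrightarrow> z \<in> cball (of_real x) r \<Longrightarrow> Im (F z) \<le> M" and "0 \<le> M"
    and y: "0 < y" "y < r"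
  shows "Im (F (Complex x y)) \<le> 2 * M / r * y"
proof -
  \<comment> \<open>\<open>Im b\<close> is nonnegative on the diameter of the half-disc and at least \<open>M\<close> on the arc.\<close>
  define b where "b z = of_real M * (\<i> * (z - of_real x)\<^sup>2 / of_real (r\<^sup>2) + 2 * (z - of_real x) / of_real r)" for z :: complex
  have Imb: "Im (b z) = M * (((Re z - x)\<^sup>2 - (Im z)\<^sup>2) / r\<^sup>2 + 2 * Im z / r)" for z
    by (simp add: b_def Re_power2 Im_divide_of_real del: of_real_power)
  define S where "S = ball (of_real x) r \<inter> upper_half_plane"
  have "Im (F (Complex x y) - b (Complex x y)) \<le> 0"
  proof (rule Im_le_0_maximum_principle[where F = "\<lambda>z. F z - b z" and S = S])
    show "(\<lambda>z. F z - b z) holomorphic_on S"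
      unfolding b_def S_def using \<open>0 < r\<close>
      by (intro holomorphic_intros holomorphic_on_subset[OF F]) auto
    show "open S" "bounded S"
      by (auto simp: S_def open_upper_half_plane)
    show "Complex x y \<in> S"
      using y by (simp add: S_def upper_half_plane_def dist_norm cmod_def)
    fix \<xi> :: complex and e :: real
    assume xi: "\<xi> \<in> frontier S" and "0 < e"
    have "closure S \<subseteq> cball (of_real x) r \<inter> {z. 0 \<le> Im z}"
      by (rule closure_minimal) (auto simp: S_def upper_half_plane_def closed_halfspace_Im_ge)
    moreover have "\<xi> \<in> closure S" "\<xi> \<notin> S"
      using xi \<open>open S\<close> by (auto simp: frontier_def interior_open)
    ultimately have cb: "\<xi> \<in> cball (of_real x) r" "0 \<le> Im \<xi>" by auto
    have contb: "((\<lambda>z. Im (b z)) \<longlongrightarrow> Im (b \<xi>)) (at \<xi> within S)"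
      unfolding b_def by (intro tendsto_intros) (use \<open>0 < r\<close> in auto)
    have *: "\<forall>\<^sub>F z in at \<xi> within S. Im (F z - b z) < e"
      \<comment> \<open>The limit \<open>l\<close> is 0 on the diameter, including its endpoints,
        and \<open>Im (F \<xi>)\<close> on the open arc.\<close>
      if l: "((\<lambda>z. Im (F z)) \<longlongrightarrow> l) (at \<xi> within upper_half_plane)" "l \<le> Im (b \<xi>)" for l
    proof -
      have "((\<lambda>z. Im (F z)) \<longlongrightarrow> l) (at \<xi> within S)"
        using l(1) by (rule tendsto_within_subset) (auto simp: S_def)
      from tendsto_diff[OF this contb] have "((\<lambda>z. Im (F z - b z)) \<longlongrightarrow> l - Im (b \<xi>)) (at \<xi> within S)" by simp
      then show ?thesis using l(2) \<open>0 < e\<close> by (auto dest!: order_tendstoD(2)[where a = e])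
    qed
    show "\<forall>\<^sub>F z in at \<xi> within S. Im (F z - b z) < e"
    proof (cases "Im \<xi> = 0")
      case True
      then have "\<xi> = of_real (Re \<xi>)" by (simp add: complex_eq_iff)
      then have "((\<lambda>z. Im (F z)) \<longlongrightarrow> 0) (at \<xi> within upper_half_plane)" using lim by metis
      then show ?thesis by (rule *) (use True \<open>0 \<le> M\<close> in \<open>simp add: Imb\<close>)
    next
      case False
      then have "\<xi> \<in> upper_half_plane" using cb by (simp add: upper_half_plane_def)
      then have "dist (of_real x) \<xi> = r" using cb \<open>\<xi> \<notin> S\<close> by (auto simp: S_def)
      then have r2: "r\<^sup>2 = (Re \<xi> - x)\<^sup>2 + (Im \<xi>)\<^sup>2"
        by (auto simp: dist_norm cmod_power2 power2_commute[of x])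
      have "\<bar>Im \<xi>\<bar> \<le> r" unfolding \<open>dist (of_real x) \<xi> = r\<close>[symmetric] dist_norm
        using abs_Im_le_cmod[of "of_real x - \<xi>"] by simp
      show ?thesis
      proof (rule *)
        show "((\<lambda>z. Im (F z)) \<longlongrightarrow> Im (F \<xi>)) (at \<xi> within upper_half_plane)"
          using holomorphic_on_imp_continuous_on[OF F] \<open>\<xi> \<in> upper_half_plane\<close>
          by (intro tendsto_intros) (simp add: continuous_on_def)
        have "Im (F \<xi>) \<le> M * 1" using M[OF \<open>\<xi> \<in> upper_half_plane\<close> cb(1)] by simp
        also have "\<dots> \<le> Im (b \<xi>)"
          unfolding Imb
        proof (rule mult_left_mono)
          \<comment> \<open>On the arc the numerator of the barrier, over the common denominator
            \<open>r\<^sup>2\<close>, equals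
            \<open>r\<^sup>2 - 2 * (Im \<xi>)\<^sup>2 + 2 * Im \<xi> * r\<close>. It is at least
            \<open>r\<^sup>2\<close> because \<open>Im \<xi>\<close> lies between 0 and
            \<open>r\<close>.\<close>
          have "(Im \<xi>)\<^sup>2 \<le> Im \<xi> * r"
            using cb \<open>\<bar>Im \<xi>\<bar> \<le> r\<close> by (simp add: power2_eq_square mult_left_mono)
          then have "r\<^sup>2 \<le> (Re \<xi> - x)\<^sup>2 - (Im \<xi>)\<^sup>2 + 2 * Im \<xi> * r"
            using r2 by linarith
          then show "1 \<le> ((Re \<xi> - x)\<^sup>2 - (Im \<xi>)\<^sup>2) / r\<^sup>2 + 2 * Im \<xi> / r"
            using \<open>0 < r\<close> by (simp add: field_simps power2_eq_square)
        qed (rule \<open>0 \<le> M\<close>)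
        finally show "Im (F \<xi>) \<le> Im (b \<xi>)" .
      qed
    qed
  qed
  then have "Im (F (Complex x y)) \<le> M * (2 * y / r - y\<^sup>2 / r\<^sup>2)" by (simp add: Imb)
  also have "\<dots> \<le> M * (2 * y / r)"
    using \<open>0 \<le> M\<close> by (intro mult_left_mono) auto
  finally show ?thesis by (simp add: field_simps)
qed

text \<open>Extended by 0 to the axis, \<open>Im F\<close> is continuous on the closed half-plane by
  the boundary limits, hence bounded on the compact half-disc of radius \<open>A\<close>.\<close>

lemma Im_bounded_near_real_axis:
  assumes F: "F holomorphic_on upper_half_plane"
    and lim: "\<And>x::real. ((\<lambda>z. Im (F z)) \<longlongrightarrow> 0) (at (of_real x) within upper_half_plane)"
  obtains M where "0 < M"
    "\<And>z. z \<in> upper_half_plane \<Longrightarrow> norm z \<le> A \<Longrightarrow> \<bar>Im (F z)\<bar> \<le> M"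
proof -
  define v where "v z = (if Im z > 0 then Im (F z) else 0)" for z
  have "continuous_on {z. 0 \<le> Im z} v"
    unfolding continuous_on_def
  proof
    fix z assume "z \<in> {z. 0 \<le> Im z}"
    show "(v \<longlongrightarrow> v z) (at z within {z. 0 \<le> Im z})"
    proof (cases "Im z > 0")
      case True
      then have "z \<in> upper_half_plane" by (simp add: upper_half_plane_def)
      then have "((\<lambda>w. Im (F w)) \<longlongrightarrow> Im (F z)) (at z)"
        using holomorphic_on_imp_continuous_on[OF F] at_within_open[OF _ open_upper_half_plane]
        by (intro tendsto_intros) (metis continuous_on_def)
      then have "(v \<longlongrightarrow> Im (F z)) (at z)"
        by (rule Lim_transform_within_open[OF _ open_upper_half_plane \<open>z \<in> upper_half_plane\<close>])
          (simp add: v_def upper_half_plane_def)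
      then show ?thesis
        using True by (simp add: v_def[of z] tendsto_within_subset[where S = UNIV])
    next
      case False
      with \<open>z \<in> _\<close> have "z = of_real (Re z)" by (simp add: complex_eq_iff)
      with lim have "((\<lambda>z. Im (F z)) \<longlongrightarrow> 0) (at z within upper_half_plane)" by metis
      then have "(v \<longlongrightarrow> 0) (at z within {z. 0 \<le> Im z})"
        unfolding v_def
        by (intro filterlim_at_within_If)
          (auto elim: tendsto_within_subset simp: upper_half_plane_def)
      then show ?thesis using False by (simp add: v_def[of z])
    qed
  qed
  then have "continuous_on ({z. 0 \<le> Im z} \<inter> cball 0 A) v"
    by (rule continuous_on_subset) auto
  then have "bounded (v ` ({z. 0 \<le> Im z} \<inter> cball 0 A))"
    by (intro compact_imp_bounded compact_continuous_image closed_Int_compact closed_halfspace_Im_ge)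
      auto
  then obtain M where M: "0 < M" "\<And>z. 0 \<le> Im z \<Longrightarrow> norm z \<le> A \<Longrightarrow> norm (v z) \<le> M"
    unfolding bounded_pos by auto
  show ?thesis
  proof (rule that[OF M(1)])
    show "\<bar>Im (F z)\<bar> \<le> M" if "z \<in> upper_half_plane" "norm z \<le> A" for z
      using M(2)[of z] that by (simp add: v_def upper_half_plane_def)
  qed
qed

text \<open>On the disc about \<open>z\<close> of radius half of \<open>y = Im z\<close>, the linear
  decay bounds \<open>Im F\<close> by \<open>3 * M * y\<close>. Dividing by the radius in the
  derivative estimate cancels \<open>y\<close>, so the bound is uniform up to the axis.\<close>

lemma norm_deriv_bounded_near_real_axis:
  assumes F: "F holomorphic_on upper_half_plane"
    and lim: "\<And>x::real. ((\<lambda>z. Im (F z)) \<longlongrightarrow> 0) (at (of_real x) within upper_half_plane)"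
  obtains B where
    "\<And>z. z \<in> upper_half_plane \<Longrightarrow> z \<in> ball (of_real x) (1/2) \<Longrightarrow> norm (deriv F z) \<le> B"
proof -
  \<comment> \<open>The margin 2 accommodates all unit discs centred at real points of modulus at
    most \<open>\<bar>x\<bar> + 1\<close>.\<close>
  obtain M where M: "0 < M"
    "\<And>z. z \<in> upper_half_plane \<Longrightarrow> norm z \<le> \<bar>x\<bar> + 2 \<Longrightarrow> \<bar>Im (F z)\<bar> \<le> M"
    using Im_bounded_near_real_axis[OF F lim] by blast
  have ImF: "\<bar>Im (F w)\<bar> \<le> 2 * M * Im w" if w: "0 < Im w" "Im w < 1" "\<bar>Re w\<bar> \<le> \<bar>x\<bar> + 1" for w
  proof -
    have bd: "\<bar>Im (F z)\<bar> \<le> M" if "z \<in> upper_half_plane" "z \<in> cball (of_real (Re w)) 1" for z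
    proof (rule M(2))
      have "norm z \<le> norm (z - of_real (Re w)) + norm (of_real (Re w) :: complex)"
        by (metis norm_triangle_ineq diff_add_cancel)
      then show "norm z \<le> \<bar>x\<bar> + 2"
        using that w by (simp add: dist_norm norm_minus_commute)
    qed (fact that)
    have "Im (F (Complex (Re w) (Im w))) \<le> 2 * M / 1 * Im w"
      by (rule Im_le_near_real_axis[OF F lim]) (use bd M w in \<open>auto simp: abs_le_iff\<close>)
    moreover have "Im (- F (Complex (Re w) (Im w))) \<le> 2 * M / 1 * Im w"
    proof (rule Im_le_near_real_axis)
      show "(\<lambda>z. - F z) holomorphic_on upper_half_plane" using F by (rule holomorphic_on_minus)
      show "((\<lambda>z. Im (- F z)) \<longlongrightarrow> 0) (at (of_real x) within upper_half_plane)" for x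
        using tendsto_minus[OF lim[of x]] by simp
      show "Im (- F z) \<le> M" if "z \<in> upper_half_plane" "z \<in> cball (of_real (Re w)) 1" for z
        using bd[OF that] by simp
    qed (use M w in auto)
    ultimately show ?thesis by simp
  qed
  show ?thesis
  proof (rule that)
    fix z assume z: "z \<in> upper_half_plane" "z \<in> ball (of_real x) (1/2)"
    define y where "y = Im z"
    have "0 < y" using z by (simp add: y_def upper_half_plane_def)
    have "norm (z - of_real x) < 1/2" using z by (simp add: dist_norm norm_minus_commute)
    then have "y < 1/2" "\<bar>Re z - x\<bar> < 1/2"
      using abs_Im_le_cmod[of "z - of_real x"] abs_Re_le_cmod[of "z - of_real x"] by (auto simp: y_def)
    have near: "\<bar>Im w - y\<bar> \<le> y / 2" "\<bar>Re w - Re z\<bar> \<le> y / 2" if "w \<in> cball z (y/2)" for w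
      using abs_Im_le_cmod[of "w - z"] abs_Re_le_cmod[of "w - z"] that
      by (auto simp: y_def dist_norm norm_minus_commute)
    have "norm (deriv F z) \<le> exp 2 * (3 * M * y) / (y / 2)"
    proof (rule norm_deriv_le_of_Im_bound[OF F open_upper_half_plane])
      show "cball z (y/2) \<subseteq> upper_half_plane"
        using near(1) \<open>0 < y\<close> unfolding upper_half_plane_def by (smt (verit) field_sum_of_halves mem_Collect_eq subsetI)
      fix w assume w: "w \<in> cball z (y/2)"
      have "0 < Im w" "Im w < 1" "\<bar>Re w\<bar> \<le> \<bar>x\<bar> + 1" "Im w \<le> 3 / 2 * y"
        using near[OF w] \<open>0 < y\<close> \<open>y < 1/2\<close> \<open>\<bar>Re z - x\<bar> < 1/2\<close> unfolding abs_le_iff abs_less_iff by linarith+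
      note ImF[OF this(1-3)]
      also have "2 * M * Im w \<le> 2 * M * (3 / 2 * y)"
        using \<open>Im w \<le> 3 / 2 * y\<close> M(1) by (intro mult_left_mono) auto
      finally show "\<bar>Im (F w)\<bar> \<le> 3 * M * y" by simp
    qed (use \<open>0 < y\<close> M in auto)
    then show "norm (deriv F z) \<le> exp 2 * 6 * M" using \<open>0 < y\<close> by simp
  qed
qed

section \<open>Continuous extension to the real axis and Schwarz reflection\<close>

lemma real_islimpt_upper_half_plane: "of_real x islimpt upper_half_plane"
proof -
  have "of_real x + \<i> * of_real (e / 2) \<in> upper_half_plane \<and>
    dist (of_real x + \<i> * of_real (e / 2)) (of_real x) < e \<and> of_real x + \<i> * of_real (e / 2) \<noteq> of_real x"
    if "e > 0" for e using that by (auto simp: upper_half_plane_def dist_norm norm_mult complex_eq_iff)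
  then show ?thesis unfolding islimpt_approachable by blast
qed

text \<open>A bounded derivative on the convex half-disc \<open>X\<close> makes \<open>F\<close>
  Lipschitz there. Thus \<open>F\<close> is uniformly continuous and has limits at the points of the
  closure, among them \<open>x\<close>.\<close>

lemma limit_exists_at_real:
  assumes F: "F holomorphic_on upper_half_plane"
    and lim: "\<And>x::real. ((\<lambda>z. Im (F z)) \<longlongrightarrow> 0) (at (of_real x) within upper_half_plane)"
  obtains l where "(F \<longlongrightarrow> l) (at (of_real x) within upper_half_plane)"
proof -
  define X where "X = ball (of_real x) (1/2) \<inter> upper_half_plane"
  have eq: "at (of_real x) within X = at (of_real x) within upper_half_plane"
    by (rule at_within_nhd[where S = "ball (of_real x) (1/2)"]) (auto simp: X_def)
  obtain B where B: "\<And>z. z \<in> X \<Longrightarrow> norm (deriv F z) \<le> B"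
    unfolding X_def using norm_deriv_bounded_near_real_axis[OF F lim] by (metis IntD1 IntD2)
  have "convex X" by (simp add: X_def convex_Int convex_upper_half_plane)
  have lip: "norm (F z - F w) \<le> B * norm (z - w)" if "z \<in> X" "w \<in> X" for z w
  proof (rule field_differentiable_bound[OF \<open>convex X\<close> _ B that])
    show "(F has_field_derivative deriv F z) (at z within X)" if "z \<in> X" for z
      using that holomorphic_derivI[OF F open_upper_half_plane] by (simp add: X_def)
  qed
  \<comment> \<open>The maximum with 0 supplies a nonnegative Lipschitz constant, since the sign of
    \<open>B\<close> is not known.\<close>
  have "(max B 0)-lipschitz_on X F"
  proof (rule lipschitz_onI)
    show "dist (F z) (F w) \<le> max B 0 * dist z w" if "z \<in> X" "w \<in> X" for z w
      using lip[OF that] mult_right_mono[of B "max B 0" "dist z w"] by (simp add: dist_norm)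
  qed simp
  then have "uniformly_continuous_on X F" by (rule lipschitz_on_uniformly_continuous)
  moreover have "of_real x islimpt X"
    using real_islimpt_upper_half_plane[of x] eq by (metis trivial_limit_within)
  then have "of_real x \<in> closure X" by (simp add: closure_def)
  ultimately obtain l where "(F \<longlongrightarrow> l) (at (of_real x) within X)"
    using uniformly_continuous_on_extension_at_closure by blast
  with that eq show ?thesis by metis
qed

text \<open>The limits at real points define a continuous extension \<open>g\<close> to the closed
  half-plane. It is real on the axis because \<open>Im F\<close> tends to 0 there, so the Schwarz
  reflection principle glues \<open>g\<close> to its conjugate reflection.\<close>

lemma entire_extension_by_reflection:
  assumes F: "F holomorphic_on upper_half_plane"
    and lim: "\<And>x::real. ((\<lambda>z. Im (F z)) \<longlongrightarrow> 0) (at (of_real x) within upper_half_plane)"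
  obtains G where "G holomorphic_on UNIV" "\<And>z. z \<in> upper_half_plane \<Longrightarrow> G z = F z"
    "\<And>z. G (cnj z) = cnj (G z)"
proof -
  \<comment> \<open>This translates the punctured neighbourhood filter of an abstract topological
    space, in which the extension theorem for regular spaces is phrased, into the usual one.\<close>
  have atin: "atin_within euclidean t upper_half_plane = at t within upper_half_plane" for t :: complex
    by (rule filter_eqI) (auto simp: eventually_atin_within eventually_at_topological)
  have limits: "\<exists>l. limitin euclidean F l (atin_within euclidean t upper_half_plane)"
    if "t \<in> {z. 0 \<le> Im z} - upper_half_plane" for t
  proof -
    from that have "t = of_real (Re t)" by (simp add: upper_half_plane_def complex_eq_iff)
    then show ?thesis using limit_exists_at_real[OF F lim, of "Re t"]
      by (metis limitin_canonical_iff atin)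
  qed
  have closure: "{z. 0 \<le> Im z} \<subseteq> closure upper_half_plane"
  proof
    fix z assume z: "z \<in> {z. 0 \<le> Im z}"
    show "z \<in> closure upper_half_plane"
    proof (cases "Im z = 0")
      case True
      then have "z = of_real (Re z)" by (simp add: complex_eq_iff)
      then show ?thesis using real_islimpt_upper_half_plane[of "Re z"] by (simp add: closure_def)
    qed (use z closure_subset in \<open>force simp: upper_half_plane_def\<close>)
  qed
  obtain g where "continuous_map (subtopology euclidean {z. 0 \<le> Im z}) euclidean g"
    and gF: "\<And>z. z \<in> upper_half_plane \<Longrightarrow> g z = F z"
  proof (rule continuous_map_extension_pointwise_alt
      [of euclidean upper_half_plane "{z. 0 \<le> Im z}" euclidean F])
    show "upper_half_plane \<subseteq> {z. 0 \<le> Im z}" by (auto simp: upper_half_plane_def)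
    show "continuous_map (subtopology euclidean upper_half_plane) euclidean F"
      using holomorphic_on_imp_continuous_on[OF F] by simp
  qed (use closure limits regular_space_euclidean in auto)
  then have g: "continuous_on {z. 0 \<le> Im z} g" by simp
  have real: "g z \<in> \<real>" if zR: "z \<in> \<real>" for z
  proof -
    obtain x where x: "z = of_real x" using zR by (rule Reals_cases)
    have "(g \<longlongrightarrow> g z) (at z within {z. 0 \<le> Im z})"
      using g x by (simp add: continuous_on_def)
    then have "(g \<longlongrightarrow> g z) (at z within upper_half_plane)"
      by (rule tendsto_within_subset) (auto simp: upper_half_plane_def)
    then have "((\<lambda>w. Im (g w)) \<longlongrightarrow> Im (g z)) (at z within upper_half_plane)" by (rule tendsto_Im)
    moreover have "((\<lambda>w. Im (g w)) \<longlongrightarrow> 0) (at z within upper_half_plane)"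
      using lim[of x] unfolding x
      by (rule Lim_transform_eventually) (auto simp: eventually_at_filter gF)
    ultimately have "Im (g z) = 0"
      using real_islimpt_upper_half_plane[of x] unfolding x
      by (metis tendsto_unique trivial_limit_within)
    then show ?thesis by (simp add: complex_is_Real_iff)
  qed
  define G where "G z = (if 0 \<le> Im z then g z else cnj (g (cnj z)))" for z
  have "g holomorphic_on upper_half_plane"
    using F gF holomorphic_cong by blast
  then have "G holomorphic_on UNIV"
    unfolding G_def using Schwarz_reflection[of UNIV g] g real
    by (simp add: upper_half_plane_def)
  moreover have "G (cnj z) = cnj (G z)" for z
  proof (cases "Im z = 0")
    case True
    then have "z \<in> \<real>" by (simp add: complex_is_Real_iff)
    with real show ?thesis by (simp add: G_def Reals_cnj_iff)
  qed (auto simp: G_def)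
  moreover have "G z = F z" if "z \<in> upper_half_plane" for z
    using that gF by (simp add: G_def upper_half_plane_def)
  ultimately show ?thesis using that by blast
qed

section \<open>Temperate growth of the derivative\<close>

text \<open>On the disc of radius \<open>Im z / 2\<close> about \<open>z\<close>, the quantity
  \<open>(norm w)\<^sup>2 / Im w\<close> is comparable with its value \<open>t\<close> at the
  centre. The derivative estimate therefore preserves the growth, and the additional factor
  \<open>1 / Im z\<close> is at most \<open>t\<close>, which raises the exponent by one.\<close>

lemma deriv_growth_in_upper_half_plane:
  assumes F: "F holomorphic_on upper_half_plane"
    and "0 < C" "0 < N"
    and growth: "\<And>z. z \<in> upper_half_plane \<Longrightarrow> R < norm z \<Longrightarrow>
      \<bar>Im (F z)\<bar> \<le> C * ((norm z)\<^sup>2 / Im z) powr N"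
  obtains C' R' :: real and n :: nat where "0 < C'" "1 \<le> R'" "0 < n"
    "\<And>z. z \<in> upper_half_plane \<Longrightarrow> R' < norm z \<Longrightarrow>
      norm (deriv F z) \<le> C' * ((norm z)\<^sup>2 / Im z) ^ n"
proof
  \<comment> \<open>The exponent is rounded up to a natural number, as a polynomial factor is to
    cancel it later; this enlarges the bound because the base \<open>5 * t\<close> is at least
    1.\<close>
  define k where "k = nat \<lceil>N\<rceil>"
  \<comment> \<open>A threshold of at least \<open>2 * R\<close> keeps the disc about
    \<open>z\<close> in the region where the growth bound holds, since \<open>norm w\<close> is at
    least half of \<open>norm z\<close>. A threshold of at least 1 ensures that both 1 and
    \<open>1 / y\<close> are at most \<open>t\<close>.\<close>
  show "0 < 2 * exp 2 * C * 5 ^ k" "1 \<le> max 1 (2 * R)" "0 < Suc k" using \<open>0 < C\<close> by auto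
  fix z assume z: "z \<in> upper_half_plane" "max 1 (2 * R) < norm z"
  define y t where "y = Im z" and "t = (norm z)\<^sup>2 / y"
  have "0 < y" "y \<le> norm z"
    using z abs_Im_le_cmod[of z] by (auto simp: y_def upper_half_plane_def)
  have "1 * y \<le> norm z * norm z" using z \<open>0 < y\<close> \<open>y \<le> norm z\<close> by (intro mult_mono) auto
  then have "1 \<le> t" using \<open>0 < y\<close> by (simp add: t_def power2_eq_square)
  have "1 \<le> (norm z)\<^sup>2" using z by simp
  then have "1 / y \<le> t" using \<open>0 < y\<close> unfolding t_def by (intro divide_right_mono) auto
  have near: "y / 2 \<le> Im w" "norm z / 2 \<le> norm w" "norm w \<le> 3 / 2 * norm z"
    if "w \<in> cball z (y/2)" for w
  proof -
    have "norm (z - w) \<le> y / 2" using that by (simp add: dist_norm)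
    then show "y / 2 \<le> Im w" "norm z / 2 \<le> norm w" "norm w \<le> 3 / 2 * norm z"
      using abs_Im_le_cmod[of "z - w"] norm_triangle_sub[of z w] norm_triangle_sub[of w z] \<open>y \<le> norm z\<close>
      by (auto simp: y_def norm_minus_commute)
  qed
  have "norm (deriv F z) \<le> exp 2 * (C * (5 * t) ^ k) / (y / 2)"
  proof (rule norm_deriv_le_of_Im_bound[OF F open_upper_half_plane])
    show "cball z (y/2) \<subseteq> upper_half_plane"
      using near(1) \<open>0 < y\<close> unfolding upper_half_plane_def by fastforce
    fix w assume w: "w \<in> cball z (y/2)"
    \<comment> \<open>The exact factor is \<open>(3/2)\<^sup>2 * 2 = 9/2\<close>, rounded up to
      5.\<close>
    have "(norm w)\<^sup>2 / Im w \<le> (3 / 2 * norm z)\<^sup>2 / (y / 2)"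
      using near[OF w] \<open>0 < y\<close> by (intro frac_le power_mono) auto
    also have "\<dots> \<le> 5 * t"
      using \<open>1 \<le> t\<close> \<open>0 < y\<close> by (simp add: t_def power2_eq_square field_simps)
    finally have le: "(norm w)\<^sup>2 / Im w \<le> 5 * t" .
    have "\<bar>Im (F w)\<bar> \<le> C * ((norm w)\<^sup>2 / Im w) powr N"
      using near[OF w] \<open>0 < y\<close> z by (intro growth) (auto simp: upper_half_plane_def)
    also have "\<dots> \<le> C * (5 * t) powr N"
      using le \<open>0 < N\<close> \<open>0 < C\<close> near[OF w] \<open>0 < y\<close> by (intro mult_left_mono powr_mono2) auto
    also have "\<dots> \<le> C * (5 * t) powr real k"
      using \<open>1 \<le> t\<close> \<open>0 < C\<close> unfolding k_def by (intro mult_left_mono powr_mono) linarith+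
    also have "(5 * t) powr real k = (5 * t) ^ k"
      using \<open>1 \<le> t\<close> by (simp add: powr_realpow)
    finally show "\<bar>Im (F w)\<bar> \<le> C * (5 * t) ^ k" .
  qed (use \<open>0 < y\<close> \<open>0 < C\<close> \<open>1 \<le> t\<close> in auto)
  also have "\<dots> = 2 * exp 2 * C * 5 ^ k * (t ^ k * (1 / y))"
    using \<open>0 < y\<close> by (simp add: power_mult_distrib field_simps)
  also have "\<dots> \<le> 2 * exp 2 * C * 5 ^ k * (t ^ k * t)"
    using \<open>1 / y \<le> t\<close> \<open>1 \<le> t\<close> \<open>0 < C\<close> by (intro mult_left_mono) auto
  finally show "norm (deriv F z) \<le> 2 * exp 2 * C * 5 ^ k * ((norm z)\<^sup>2 / Im z) ^ Suc k"
    by (simp add: t_def y_def mult.commute)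
qed

section \<open>Entire functions and polynomials\<close>

text \<open>The factor \<open>(w\<^sup>2 - \<rho>\<^sup>2) ^ n\<close> removes the blow-up of the
  bound near the two real points of the circle of radius \<open>\<rho>\<close>. The maximum
  principle carries the resulting bound into the disc, and on the half-size disc the factor is large
  enough to be divided out.\<close>

lemma entire_growth_off_real_axis:
  assumes f: "f holomorphic_on UNIV" and "0 \<le> C" "0 \<le> R" "0 < n"
    and growth: "\<And>z. R < norm z \<Longrightarrow> Im z \<noteq> 0 \<Longrightarrow> norm (f z) \<le> C * ((norm z)\<^sup>2 / \<bar>Im z\<bar>) ^ n"
    and "R < \<rho>" "norm z \<le> \<rho> / 2"
  shows "norm (f z) \<le> C * (4 * \<rho>) ^ n"
proof -
  define h where "h w = f w * (w\<^sup>2 - of_real (\<rho>\<^sup>2)) ^ n" for w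
  have "0 < \<rho>" using assms by simp
  have "norm (h z) \<le> C * (2 * \<rho> ^ 3) ^ n"
  proof (rule maximum_modulus_frontier[where f = h and S = "cball 0 \<rho>"])
    have hol: "h holomorphic_on A" for A
      unfolding h_def by (intro holomorphic_intros holomorphic_on_subset[OF f]) auto
    show "h holomorphic_on interior (cball 0 \<rho>)" "continuous_on (closure (cball 0 \<rho>)) h"
      using hol holomorphic_on_imp_continuous_on by blast+
    show "z \<in> cball 0 \<rho>" using assms by simp
    fix w :: complex assume "w \<in> frontier (cball 0 \<rho>)"
    then have w: "norm w = \<rho>" using \<open>0 < \<rho>\<close> by (simp add: frontier_cball)
    \<comment> \<open>On the circle \<open>\<rho>\<^sup>2\<close> equals \<open>w * cnj w\<close>,
      so the factor has modulus exactly proportional to \<open>\<bar>Im w\<bar>\<close>.\<close>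
    have "w\<^sup>2 - of_real (\<rho>\<^sup>2) = w * (w - cnj w)"
      using complex_norm_square[of w] w by (simp add: power2_eq_square algebra_simps)
    moreover have "w - cnj w = of_real (2 * Im w) * \<i>" by (simp add: complex_eq_iff)
    ultimately have nw: "norm (w\<^sup>2 - of_real (\<rho>\<^sup>2)) = 2 * \<rho> * \<bar>Im w\<bar>"
      using w by (simp add: norm_mult)
    show "norm (h w) \<le> C * (2 * \<rho> ^ 3) ^ n"
    proof (cases "Im w = 0")
      \<comment> \<open>The growth hypothesis says nothing at real points, but there the factor
        vanishes because \<open>n\<close> is positive.\<close>
      case True
      then show ?thesis
        using nw \<open>0 < n\<close> \<open>0 \<le> C\<close> \<open>0 < \<rho>\<close> by (simp add: h_def norm_mult norm_power zero_power)
    next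
      case False
      have "norm (h w) = norm (f w) * (2 * \<rho> * \<bar>Im w\<bar>) ^ n"
        unfolding h_def norm_mult norm_power nw ..
      also have "\<dots> \<le> C * (\<rho>\<^sup>2 / \<bar>Im w\<bar>) ^ n * (2 * \<rho> * \<bar>Im w\<bar>) ^ n"
        using growth[of w] False w \<open>R < \<rho>\<close> \<open>0 < \<rho>\<close> by (intro mult_right_mono) auto
      also have "\<dots> = C * (2 * \<rho> ^ 3) ^ n"
        using False by (simp add: power_mult_distrib[symmetric] power2_eq_square power3_eq_cube mult_ac)
      finally show ?thesis .
    qed
  qed simp
  \<comment> \<open>For \<open>norm z \<le> \<rho> / 2\<close> the factor
    \<open>z\<^sup>2 - \<rho>\<^sup>2\<close> has modulus at least
    \<open>3/4 * \<rho>\<^sup>2\<close>; the weaker value \<open>\<rho>\<^sup>2 / 2\<close> turns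
    \<open>2 * \<rho> ^ 3\<close> into \<open>4 * \<rho>\<close>.\<close>
  moreover have "norm (f z) * (\<rho>\<^sup>2 / 2) ^ n \<le> norm (h z)"
  proof -
    have "(norm z)\<^sup>2 \<le> \<rho>\<^sup>2 / 4"
      using power_mono[OF assms(7), of 2] by (simp add: power_divide)
    moreover have "\<rho>\<^sup>2 - (norm z)\<^sup>2 \<le> norm (z\<^sup>2 - of_real (\<rho>\<^sup>2))"
      using norm_triangle_ineq3[of "z\<^sup>2" "of_real (\<rho>\<^sup>2)"] by (simp add: norm_power abs_le_iff del: of_real_power)
    moreover have "0 \<le> \<rho>\<^sup>2" by simp
    ultimately have "\<rho>\<^sup>2 / 2 \<le> norm (z\<^sup>2 - of_real (\<rho>\<^sup>2))" by linarith
    then show ?thesis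
      unfolding h_def norm_mult norm_power by (intro mult_left_mono power_mono) auto
  qed
  moreover have "2 * \<rho> ^ 3 = 4 * \<rho> * (\<rho>\<^sup>2 / 2)" by (simp add: power2_eq_square power3_eq_cube)
  then have "C * (2 * \<rho> ^ 3) ^ n = C * (4 * \<rho>) ^ n * (\<rho>\<^sup>2 / 2) ^ n"
    by (simp only: power_mult_distrib[of "4 * \<rho>"] mult.assoc[of C])
  ultimately have "norm (f z) * (\<rho>\<^sup>2 / 2) ^ n \<le> C * (4 * \<rho>) ^ n * (\<rho>\<^sup>2 / 2) ^ n" by linarith
  then show ?thesis using \<open>0 < \<rho>\<close> by (simp del: power_divide)
qed

text \<open>The mean value inequality on the disc of radius \<open>norm z\<close>, with
  \<open>\<rho> = 2 * norm z\<close> in the derivative bound, gives growth of order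
  \<open>Suc n\<close>. Liouville's theorem for polynomial growth then makes the Taylor expansion at
  0 finite.\<close>

lemma entire_is_polynomial:
  assumes f: "f holomorphic_on UNIV"
    and deriv: "\<And>\<rho> z. R < \<rho> \<Longrightarrow> norm z \<le> \<rho> / 2 \<Longrightarrow> norm (deriv f z) \<le> C * \<rho> ^ n"
    and "0 \<le> C"
  obtains p where "f = poly p"
proof
  have "norm (f z) \<le> (norm (f 0) + C * 2 ^ n) * norm z ^ Suc n" if z: "max 1 \<bar>R\<bar> \<le> norm z" for z
  proof -
    have "norm (f z - f 0) \<le> (C * (2 * norm z) ^ n) * norm (z - 0)"
    proof (rule field_differentiable_bound)
      show "(f has_field_derivative deriv f w) (at w within cball 0 (norm z))" for w
        using f by (simp add: holomorphic_derivI[of f UNIV])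
      show "norm (deriv f w) \<le> C * (2 * norm z) ^ n" if "w \<in> cball 0 (norm z)" for w
        using that z by (intro deriv) auto
    qed auto
    moreover have "1 \<le> norm z ^ Suc n" using z by (intro one_le_power) auto
    then have "norm (f 0) * 1 \<le> norm (f 0) * norm z ^ Suc n" by (intro mult_left_mono) auto
    moreover have "norm (f z) \<le> norm (f z - f 0) + norm (f 0)" by (metis norm_triangle_ineq diff_add_cancel)
    ultimately show ?thesis by (simp add: power_mult_distrib algebra_simps)
  qed
  from Liouville_polynomial[OF f this]
  have "f z = (\<Sum>k\<le>Suc n. (deriv ^^ k) f 0 / fact k * z ^ k)" for z .
  then show "f = poly (\<Sum>k\<le>Suc n. monom ((deriv ^^ k) f 0 / fact k) k)"
    by (intro ext) (simp only: poly_sum poly_monom)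
qed

section \<open>Rigidity of polynomials\<close>

text \<open>Dividing \<open>q\<close> by its variable leaves the polynomial
  \<open>pCons a p\<close>, which tends to 0 along the imaginary axis. A nonconstant polynomial
  tends to infinity in modulus, so \<open>p\<close> vanishes, and then the constant \<open>a\<close>
  is its own limit 0.\<close>

lemma poly_eq_0_of_sublinear_on_imaginary_axis:
  fixes q :: "complex poly"
  assumes "poly q 0 = 0"
    and lim: "((\<lambda>y. poly q (\<i> * of_real y) / of_real y) \<longlongrightarrow> 0) at_top"
  shows "q = 0"
proof -
  obtain a p where q: "q = pCons 0 (pCons a p)"
    using \<open>poly q 0 = 0\<close> by (metis pCons_cases poly_0_coeff_0 coeff_pCons_0)
  have "\<forall>\<^sub>F y in at_top. norm (poly q (\<i> * of_real y) / of_real y) = norm (poly (pCons a p) (\<i> * of_real y))"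
    using eventually_gt_at_top[of 0] by eventually_elim (simp add: q norm_mult norm_divide)
  with tendsto_norm_zero[OF lim]
  have lim': "((\<lambda>y. norm (poly (pCons a p) (\<i> * of_real y))) \<longlongrightarrow> 0) at_top"
    by (rule Lim_transform_eventually)
  have "p = 0"
  proof (rule ccontr)
    assume "p \<noteq> 0"
    then obtain r where r: "\<And>z. r \<le> norm z \<Longrightarrow> 1 \<le> norm (poly (pCons a p) z)"
      using poly_infinity by blast
    have "\<forall>\<^sub>F y in at_top. 1 \<le> norm (poly (pCons a p) (\<i> * of_real y))"
      using eventually_ge_at_top[of "\<bar>r\<bar>"] by eventually_elim (rule r, simp add: norm_mult)
    with lim' have "(1::real) \<le> 0" by (intro tendsto_lowerbound) auto
    then show False by simp
  qed
  with lim' have "a = 0" by (simp add: tendsto_const_iff)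
  with q \<open>p = 0\<close> show ?thesis by simp
qed

text \<open>The polynomial takes the value \<open>poly p w\<close> at the infinitely many points
  \<open>w + n d\<close>, so its difference from that constant has infinitely many roots.\<close>

lemma poly_periodic_const:
  fixes p :: "'a::field_char_0 poly"
  assumes "d \<noteq> 0" "\<And>z. poly p (z + d) = poly p z"
  shows "poly p z = poly p w"
proof -
  have "poly p (z + of_nat n * d) = poly p z" for n z
  proof (induction n)
    case (Suc n)
    then show ?case using assms(2)[of "z + of_nat n * d"] by (simp add: algebra_simps)
  qed simp
  then have "range (\<lambda>n. z + of_nat n * d) \<subseteq> {x. poly (p - [:poly p z:]) x = 0}" for z by auto
  moreover have "infinite (range (\<lambda>n::nat. z + of_nat n * d))" for z
    using \<open>d \<noteq> 0\<close> by (intro range_inj_infinite) (simp add: inj_def)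
  ultimately have "infinite {x. poly (p - [:poly p w:]) x = 0}" using finite_subset by blast
  then have "p - [:poly p w:] = 0" using poly_roots_finite by blast
  then have "p = [:poly p w:]" by simp
  then have "poly p z = poly [:poly p w:] z" by (rule arg_cong)
  then show ?thesis by simp
qed

text \<open>The odd polynomial \<open>q\<close> measures the failure of symmetry. For
  \<open>w = \<i> y\<close> the points \<open>x + w\<close> and \<open>x - w\<close> are conjugate,
  so \<open>q\<close> equals \<open>2 * \<i>\<close> times the imaginary part of \<open>p\<close>
  there. This is sublinear by hypothesis, and \<open>q\<close> vanishes at 0, hence
  identically.\<close>

lemma poly_symmetric_about:
  fixes p :: "complex poly" and x :: real
  assumes cnj: "\<And>z. poly p (cnj z) = cnj (poly p z)"
    and lim: "((\<lambda>y. Im (poly p (Complex x y)) / y) \<longlongrightarrow> 0) at_top"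
  shows "poly p (of_real x + w) = poly p (of_real x - w)"
proof -
  define q where "q = pcompose p [:of_real x, 1:] - pcompose p [:of_real x, -1:]"
  have q: "poly q w = poly p (of_real x + w) - poly p (of_real x - w)" for w
    by (simp add: q_def poly_pcompose)
  have qy: "poly q (\<i> * of_real y) / of_real y = 2 * \<i> * of_real (Im (poly p (Complex x y)) / y)" for y :: real
  proof -
    have "poly q (\<i> * of_real y) = poly p (Complex x y) - poly p (cnj (Complex x y))"
      unfolding q by (simp add: Complex_eq)
    also have "\<dots> = 2 * \<i> * of_real (Im (poly p (Complex x y)))"
      unfolding cnj by (simp add: complex_eq_iff)
    finally show ?thesis by simp
  qed
  have "((\<lambda>y. 2 * \<i> * of_real (Im (poly p (Complex x y)) / y)) \<longlongrightarrow> 2 * \<i> * of_real 0) at_top"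
    by (intro tendsto_intros lim)
  then have "((\<lambda>y. poly q (\<i> * of_real y) / of_real y) \<longlongrightarrow> 0) at_top"
    unfolding qy by simp
  then have "q = 0"
    by (rule poly_eq_0_of_sublinear_on_imaginary_axis[rotated]) (simp add: q)
  then show ?thesis using q[of w] by simp
qed

section \<open>The vanishing theorem, first for \<open>Im F\<close> and then for
  \<open>u\<close>\<close>

text \<open>This is the real-valued case of the theorem, with the harmonic function written as
  \<open>Im F\<close>. Reflection and growth make \<open>F\<close> a polynomial that is real on the
  axis, and the two sublinear vertical lines give it two centres of symmetry, so it is
  constant.\<close>

lemma Im_holomorphic_eq_0:
  fixes x1 x2 :: real
  assumes F: "F holomorphic_on upper_half_plane"
    and "0 < C" "0 < N"
    and growth: "\<And>z. z \<in> upper_half_plane \<Longrightarrow> R < norm z \<Longrightarrow>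
      \<bar>Im (F z)\<bar> \<le> C * ((norm z)\<^sup>2 / Im z) powr N"
    and lim: "\<And>x::real. ((\<lambda>z. Im (F z)) \<longlongrightarrow> 0) (at (of_real x) within upper_half_plane)"
    and "x1 \<noteq> x2"
    and lim1: "((\<lambda>y. Im (F (Complex x1 y)) / y) \<longlongrightarrow> 0) at_top"
    and lim2: "((\<lambda>y. Im (F (Complex x2 y)) / y) \<longlongrightarrow> 0) at_top"
    and z: "z \<in> upper_half_plane"
  shows "Im (F z) = 0"
proof -
  obtain G where G: "G holomorphic_on UNIV" and GF: "\<And>z. z \<in> upper_half_plane \<Longrightarrow> G z = F z"
    and cnjG: "\<And>z. G (cnj z) = cnj (G z)"
    using entire_extension_by_reflection[OF F lim] by blast
  obtain C' R' :: real and n :: nat where C': "0 < C'" "1 \<le> R'" "0 < n"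
    and F': "\<And>z. z \<in> upper_half_plane \<Longrightarrow> R' < norm z \<Longrightarrow>
      norm (deriv F z) \<le> C' * ((norm z)\<^sup>2 / Im z) ^ n"
    using deriv_growth_in_upper_half_plane[OF F \<open>0 < C\<close> \<open>0 < N\<close> growth] by blast
  have derivG: "deriv G z = deriv F z" if "z \<in> upper_half_plane" for z
    using that GF by (intro complex_derivative_transform_within_open[OF _ _ open_upper_half_plane])
      (auto intro: holomorphic_on_subset[OF G] F)
  \<comment> \<open>Conjugation symmetry of the derivative transfers its growth bound to the lower
    half-plane.\<close>
  have dcnjG: "deriv G (cnj z) = cnj (deriv G z)" for z
  proof (rule DERIV_imp_deriv)
    have "((cnj \<circ> G \<circ> cnj) has_field_derivative cnj (deriv G z)) (at (cnj z))"
      using G by (intro has_field_derivative_cnj_cnj) (simp add: holomorphic_derivI[of G UNIV])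
    moreover have "cnj \<circ> G \<circ> cnj = G" using cnjG by auto
    ultimately show "(G has_field_derivative cnj (deriv G z)) (at (cnj z))" by simp
  qed
  have G': "norm (deriv G z) \<le> C' * ((norm z)\<^sup>2 / \<bar>Im z\<bar>) ^ n" if "R' < norm z" "Im z \<noteq> 0" for z
  proof (cases "Im z > 0")
    case True
    then show ?thesis using F'[of z] derivG[of z] that by (simp add: upper_half_plane_def)
  next
    case False
    then have "cnj z \<in> upper_half_plane" using that by (simp add: upper_half_plane_def)
    moreover have "norm (deriv G z) = norm (deriv G (cnj z))" by (simp add: dcnjG)
    ultimately show ?thesis using F'[of "cnj z"] derivG[of "cnj z"] False that by simp
  qed
  obtain p where p: "G = poly p"
  proof (rule entire_is_polynomial[OF G])
    show "norm (deriv G z) \<le> (C' * 4 ^ n) * \<rho> ^ n" if "R' < \<rho>" "norm z \<le> \<rho> / 2" for \<rho> z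
      using entire_growth_off_real_axis[OF holomorphic_deriv[OF G open_UNIV] _ _ \<open>0 < n\<close> G' that] C'
      by (simp add: power_mult_distrib mult.assoc)
  qed (use C' in auto)
  have limG: "((\<lambda>y. Im (poly p (Complex x y)) / y) \<longlongrightarrow> 0) at_top"
    if "((\<lambda>y. Im (F (Complex x y)) / y) \<longlongrightarrow> 0) at_top" for x
    using that
  proof (rule Lim_transform_eventually)
    show "\<forall>\<^sub>F y in at_top. Im (F (Complex x y)) / y = Im (poly p (Complex x y)) / y"
      using eventually_gt_at_top[of 0]
      by eventually_elim (simp add: GF[symmetric] p upper_half_plane_def)
  qed
  have cnjp: "poly p (cnj z) = cnj (poly p z)" for z using cnjG by (simp add: p)
  note sym = poly_symmetric_about[OF cnjp limG]
  \<comment> \<open>The point reflection about \<open>x2\<close> followed by the one about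
    \<open>x1\<close> is a translation by twice the difference of the centres.\<close>
  have periodic: "poly p (z + of_real (2 * (x2 - x1))) = poly p z" for z
  proof -
    have "poly p (z + of_real (2 * (x2 - x1))) = poly p (of_real x2 + (z + of_real (x2 - 2 * x1)))"
      by (rule arg_cong[of _ _ "poly p"]) simp
    also have "\<dots> = poly p (of_real x1 + (of_real x1 - z))"
      unfolding sym[OF lim2] by (rule arg_cong[of _ _ "poly p"]) simp
    also have "\<dots> = poly p z"
      unfolding sym[OF lim1] by simp
    finally show ?thesis .
  qed
  have "F z = poly p (of_real x1)"
    unfolding GF[OF z, symmetric] p
    by (rule poly_periodic_const[OF _ periodic]) (use \<open>x1 \<noteq> x2\<close> in \<open>simp flip: of_real_diff\<close>)
  also have "Im \<dots> = 0"
    using cnjp[of "of_real x1"] by (simp add: complex_eq_iff)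
  finally show ?thesis .
qed

theorem theorem7p2:
  fixes u :: "complex \<Rightarrow> complex" and x1 x2 :: real
  assumes "harmonic_on upper_half_plane u"
    and "temperate_growth_at_infinity u"
    and "\<And>x::real. (u \<longlongrightarrow> 0) (at (complex_of_real x) within upper_half_plane)"
    and "x1 \<noteq> x2"
    and "((\<lambda>y::real. u (Complex x1 y) / complex_of_real y) \<longlongrightarrow> 0) at_top"
    and "((\<lambda>y::real. u (Complex x2 y) / complex_of_real y) \<longlongrightarrow> 0) at_top"
  shows "\<forall>z\<in>upper_half_plane. u z = 0"
proof -
  obtain C R N :: real where CN: "C > 0" "N > 0"
    and growth: "\<And>z. z \<in> upper_half_plane \<Longrightarrow> norm z > R \<Longrightarrow> norm (u z) \<le> C * ((norm z)\<^sup>2 / Im z) powr N"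
    using assms(2) unfolding temperate_growth_at_infinity_def by blast
  \<comment> \<open>It suffices to treat the real and imaginary parts of \<open>u\<close>. A
    functional \<open>L\<close> bounded by the norm passes the growth bound on with the same
    constants, and linearity passes on both kinds of limits.\<close>
  have zero: "L (u z) = 0"
    if L: "bounded_linear L" "\<And>w. \<bar>L w\<bar> \<le> norm w" and z: "z \<in> upper_half_plane"
    for L :: "complex \<Rightarrow> real" and z
  proof -
    obtain F where F: "F holomorphic_on upper_half_plane"
      and FL: "\<And>z. z \<in> upper_half_plane \<Longrightarrow> Im (F z) = L (u z)"
      using harmonic_on_imp_Im_holomorphic[OF assms(1) convex_upper_half_plane L(1)] by blast
    have growthF: "\<bar>Im (F z)\<bar> \<le> C * ((norm z)\<^sup>2 / Im z) powr N"
      if "z \<in> upper_half_plane" "R < norm z" for z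
      using growth[OF that] L(2)[of "u z"] FL[OF that(1)] by simp
    have limF: "((\<lambda>z. Im (F z)) \<longlongrightarrow> 0) (at (of_real x) within upper_half_plane)" for x
    proof (rule Lim_transform_eventually)
      show "((\<lambda>z. L (u z)) \<longlongrightarrow> 0) (at (of_real x) within upper_half_plane)"
        using bounded_linear.tendsto_zero[OF L(1) assms(3)] .
      show "\<forall>\<^sub>F z in at (of_real x) within upper_half_plane. L (u z) = Im (F z)"
        by (auto simp: eventually_at_filter FL)
    qed
    have sublinearF: "((\<lambda>y. Im (F (Complex x y)) / y) \<longlongrightarrow> 0) at_top"
      if "((\<lambda>y. u (Complex x y) / of_real y) \<longlongrightarrow> 0) at_top" for x
    proof (rule Lim_transform_eventually)
      show "((\<lambda>y. L (u (Complex x y) / of_real y)) \<longlongrightarrow> 0) at_top"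
        using bounded_linear.tendsto_zero[OF L(1) that] .
      have scale: "L (w / of_real y) = L w / y" for w and y :: real
        using linear_scale[OF bounded_linear.linear[OF L(1)], of "inverse y" w]
        by (simp add: scaleR_conv_of_real field_simps)
      show "\<forall>\<^sub>F y in at_top. L (u (Complex x y) / of_real y) = Im (F (Complex x y)) / y"
        using eventually_gt_at_top[of 0] by eventually_elim (simp add: FL scale upper_half_plane_def)
    qed
    have "Im (F z) = 0"
      by (rule Im_holomorphic_eq_0[OF F CN growthF limF assms(4) sublinearF[OF assms(5)] sublinearF[OF assms(6)] z])
    with FL[OF z] show ?thesis by simp
  qed
  show ?thesis
    using zero[OF bounded_linear_Re abs_Re_le_cmod] zero[OF bounded_linear_Im abs_Im_le_cmod]
    by (simp add: complex_eq_iff)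
qed

end
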